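(* For each $\theta\in[0,\pi/4)$ and each $n=1,2,3,\ldots$, all roots $z\in\mathbb{C}\setminus\{0\}$ of the Laurent polynomial $L_n(z,F_\theta)$ are located within the set $$\{z\in\mathbb{C}:|z|=1,\ 2\theta<\arg z<\pi-2\theta\}\ \cup\ \{z\in\mathbb{C}:|z|=1,\ 2\theta<-\arg z<\pi-2\theta\},$$ and all of them are simple (i.e. of multiplicity one).
   Context: For $\theta\in[0,\pi/4)$, $F_\theta=\begin{bmatrix}\cos\theta&\sin\theta\\ \sin\theta&\cos\theta\end{bmatrix}$, and for $z\in\mathbb{C}\setminus\{0\}$, $n=1,2,3,\ldots$, $$S(z,F_\theta)=F_\theta\begin{bmatrix}z&0\\0&z^{-1}\end{bmatrix}F_\theta,\qquad L_n(z,F_\theta)=\operatorname{tr}\big(S(z,F_\theta)^n\big),$$ which is a Laurent polynomial in $z$. Here $\arg z\in(-\pi,\pi]$. *)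

theory Defs
  imports "HOL-Analysis.Analysis" "HOL-Computational_Algebra.Polynomial"
begin

definition F_mat :: "real \<Rightarrow> complex^2^2" where
  "F_mat \<theta> = vector [vector [complex_of_real (cos \<theta>), complex_of_real (sin \<theta>)],
                     vector [complex_of_real (sin \<theta>), complex_of_real (cos \<theta>)]]"

definition S_mat :: "complex \<Rightarrow> complex^2^2 \<Rightarrow> complex^2^2" where
  "S_mat z F = F ** vector [vector [z, 0], vector [0, inverse z]] ** F"

(* The type class operation * on vectors is componentwise, so powers of a matrix are
   iterated applications of the matrix product **. *)
definition matrix_pow :: "complex^2^2 \<Rightarrow> nat \<Rightarrow> complex^2^2" where
  "matrix_pow A n = (((**) A) ^^ n) (mat 1)"

(* Only the values at nonzero z are meaningful. *)
definition L_laurent :: "nat \<Rightarrow> complex^2^2 \<Rightarrow> complex \<Rightarrow> complex" where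
  "L_laurent n F z = trace (matrix_pow (S_mat z F) n)"

(* f is, on the punctured plane, a nonzero Laurent polynomial p(w) / w^N, and z is a
   nonzero point at which it vanishes to order m (m = 0 if z is not a root). Multiplying p
   by a power of w does not change its order at z, so m does not depend on p and N; see
   the lemma below. *)
definition laurent_root_multiplicity :: "(complex \<Rightarrow> complex) \<Rightarrow> complex \<Rightarrow> nat \<Rightarrow> bool" where
  "laurent_root_multiplicity f z m \<longleftrightarrow>
     z \<noteq> 0 \<and>
     (\<exists>(p :: complex poly) N. p \<noteq> 0 \<and> (\<forall>w. w \<noteq> 0 \<longrightarrow> f w = poly p w / w ^ N) \<and> order z p = m)"

lemma laurent_root_multiplicity_unique:
  assumes "laurent_root_multiplicity f z m" and "laurent_root_multiplicity f z m'"
  shows "m = m'"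
proof -
  obtain p N where p: "p \<noteq> 0" "\<And>w. w \<noteq> 0 \<Longrightarrow> f w = poly p w / w ^ N" "order z p = m"
    using assms(1) unfolding laurent_root_multiplicity_def by blast
  obtain q M where q: "q \<noteq> 0" "\<And>w. w \<noteq> 0 \<Longrightarrow> f w = poly q w / w ^ M" "order z q = m'"
    using assms(2) unfolding laurent_root_multiplicity_def by blast
  have z: "z \<noteq> 0"
    using assms(1) unfolding laurent_root_multiplicity_def by blast
  define d where "d = p * monom 1 M - q * monom 1 N"
  have "poly d w = 0" if "w \<noteq> 0" for w
    using p(2)[OF that] q(2)[OF that] that by (simp add: d_def poly_monom field_simps)
  then have "UNIV - {0} \<subseteq> {w. poly d w = 0}"
    by auto
  moreover have "infinite (UNIV - {0 :: complex})"
    by (simp add: infinite_UNIV_char_0)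
  ultimately have "d = 0"
    using poly_roots_finite finite_subset by blast
  then have eq: "p * monom 1 M = q * monom 1 N"
    by (simp add: d_def)
  have nz: "order z (monom (1 :: complex) k) = 0" for k
    using z by (simp add: order_0I poly_monom)
  have "order z (p * monom 1 M) = m" "order z (q * monom 1 N) = m'"
    using p q nz by (simp_all add: order_mult)
  then show ?thesis
    using eq by simp
qed

end

theory Submission
  imports Defs
begin

text \<open>Since \<open>S(z, F\<^sub>\<theta>)\<close> has trace \<open>z + 1/z\<close> and determinant \<open>c\<^sup>2\<close> with \<open>c = cos 2\<theta>\<close>,
  the traces of its powers satisfy a Chebyshev recurrence, so that \<open>L\<^sub>n = 2 c\<^sup>n cos (n \<phi>)\<close> at
  \<open>z = cis \<alpha>\<close> whenever \<open>cos \<alpha> = c cos \<phi>\<close>. The \<open>n\<close> zeros \<open>\<phi> \<in> (0, \<pi>)\<close> of \<open>cos (n \<phi>)\<close> yield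
  \<open>2n\<close> distinct points \<open>cis (\<plusminus>\<alpha>)\<close>, and as \<open>z\<^sup>n L\<^sub>n\<close> is a polynomial of degree at most \<open>2n\<close>,
  these are all its roots and they are simple.\<close>

text \<open>Cayley-Hamilton for 2 by 2 matrices, multiplied by \<open>A ** M\<close>'s factor
  \<open>M\<close> and traced. With \<open>M\<close> a power of \<open>A\<close> it becomes a
  three-term recurrence for traces of powers.\<close>

lemma trace_mult_mult_2x2:
  fixes A M :: "'a::comm_ring_1^2^2"
  shows "trace (A ** (A ** M)) = trace A * trace (A ** M) - det A * trace M"
  by (simp add: trace_def matrix_matrix_mult_def sum_2 det_2 algebra_simps)

text \<open>By cyclicity this is the trace of the diagonal factor times the square of
  \<open>F_mat \<theta>\<close>, whose diagonal entries are both 1.\<close>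

lemma trace_S_mat_F_mat: "trace (S_mat z (F_mat \<theta>)) = z + inverse z"
proof -
  have "complex_of_real (cos \<theta>) * cos \<theta> + complex_of_real (sin \<theta>) * sin \<theta> = 1"
    by (metis of_real_add of_real_mult of_real_1 sin_cos_squared_add3)
  then have "z * (complex_of_real (cos \<theta>) * cos \<theta> + complex_of_real (sin \<theta>) * sin \<theta>)
      + inverse z * (complex_of_real (cos \<theta>) * cos \<theta> + complex_of_real (sin \<theta>) * sin \<theta>) = z + inverse z"
    by simp
  then show ?thesis
    unfolding trace_def S_mat_def F_mat_def
    by (simp add: matrix_matrix_mult_def sum_2 vector_2 algebra_simps)
qed

lemma det_S_mat_F_mat:
  assumes "z \<noteq> 0"
  shows "det (S_mat z (F_mat \<theta>)) = (complex_of_real (cos (2 * \<theta>)))\<^sup>2"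
proof -
  have "det (F_mat \<theta>) = of_real (cos (2 * \<theta>))"
    by (simp add: F_mat_def det_2 vector_2 cos_double power2_eq_square)
  moreover have "det (vector [vector [z, 0], vector [0, inverse z]] :: complex^2^2) = 1"
    using assms by (simp add: det_2 vector_2)
  ultimately show ?thesis
    by (simp add: S_mat_def det_mul power2_eq_square)
qed

text \<open>The trace recurrence cleared of denominators: scaling the n-th trace by
  \<open>z ^ n\<close> turns the coefficient \<open>z + inverse z\<close> into
  \<open>1 + z * z\<close>, and the determinant \<open>c\<^sup>2\<close> into
  \<open>c\<^sup>2 * z * z\<close>.\<close>

fun L_poly :: "complex \<Rightarrow> nat \<Rightarrow> complex poly" where
  "L_poly c 0 = [:2:]"
| "L_poly c (Suc 0) = [:1, 0, 1:]"
| "L_poly c (Suc (Suc n)) = [:1, 0, 1:] * L_poly c (Suc n) - [:0, 0, c\<^sup>2:] * L_poly c n"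

lemma L_laurent_eq_L_poly:
  assumes "z \<noteq> 0"
  shows "L_laurent n (F_mat \<theta>) z = poly (L_poly (of_real (cos (2 * \<theta>))) n) z / z ^ n"
proof (induction "of_real (cos (2 * \<theta>)) :: complex" n rule: L_poly.induct)
  case 1
  then show ?case
    by (simp add: L_laurent_def matrix_pow_def trace_def mat_def sum_2)
next
  case 2
  then show ?case
    using assms by (simp add: L_laurent_def matrix_pow_def trace_S_mat_F_mat field_simps)
next
  case (3 n)
  define c where "c = complex_of_real (cos (2 * \<theta>))"
  define P where "P = poly (L_poly c (Suc n)) z"
  define Q where "Q = poly (L_poly c n) z"
  have IH: "L_laurent (Suc n) (F_mat \<theta>) z = P / (z * z ^ n)" "L_laurent n (F_mat \<theta>) z = Q / z ^ n"
    using 3 by (simp_all add: P_def Q_def c_def)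
  have "L_laurent (Suc (Suc n)) (F_mat \<theta>) z
      = (z + inverse z) * L_laurent (Suc n) (F_mat \<theta>) z - c\<^sup>2 * L_laurent n (F_mat \<theta>) z"
    using assms
    by (simp add: L_laurent_def matrix_pow_def c_def trace_mult_mult_2x2 trace_S_mat_F_mat
        det_S_mat_F_mat)
  also have "\<dots> = ((1 + z * z) * P - z * z * c\<^sup>2 * Q) / (z * (z * z ^ n))"
    unfolding IH using assms by (simp add: field_simps)
  also have "(1 + z * z) * P - z * z * c\<^sup>2 * Q = poly (L_poly c (Suc (Suc n))) z"
    by (simp add: P_def Q_def algebra_simps)
  finally show ?case
    by (simp add: c_def)
qed

lemma degree_L_poly_le: "degree (L_poly c n) \<le> 2 * n"
proof (induction c n rule: L_poly.induct)
  case (3 c n)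
  have "degree ([:1, 0, 1:] * L_poly c (Suc n)) \<le> 2 * Suc (Suc n)"
    using 3(1) degree_mult_le[of "[:1, 0, 1:]" "L_poly c (Suc n)"] by simp
  moreover have "degree ([:0, 0, c\<^sup>2:] * L_poly c n) \<le> 2 * Suc (Suc n)"
    using 3(2) degree_mult_le[of "[:0, 0, c\<^sup>2:]" "L_poly c n"]
    by (auto split: if_splits)
  ultimately show ?case
    unfolding L_poly.simps by (rule degree_diff_le)
qed auto

text \<open>Serves to show that the polynomial is nonzero. The case n = 0 differs, being the
  constant 2.\<close>

lemma poly_L_poly_0: "n > 0 \<Longrightarrow> poly (L_poly c n) 0 = 1"
  by (induction c n rule: L_poly.induct) auto

lemma poly_L_poly_cis:
  assumes "cos \<alpha> = c * cos \<phi>"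
  shows "poly (L_poly (of_real c) n) (cis \<alpha>) = cis \<alpha> ^ n * of_real (2 * c ^ n * cos (n * \<phi>))"
proof -
  \<comment> \<open>This is z + 1/z = 2 cos \<alpha> at z = \<open>cis \<alpha>\<close>, multiplied
    by z.\<close>
  have quad: "1 + cis \<alpha> * cis \<alpha> = cis \<alpha> * of_real (2 * c * cos \<phi>)"
    using sin_cos_squared_add3[of \<alpha>]
    by (simp add: complex_eq_iff mult.assoc flip: assms) (simp add: algebra_simps)
  show ?thesis
  proof (induction "of_real c :: complex" n rule: L_poly.induct)
    case 2
    show ?case
      using quad by simp
  next
    case (3 n)
    \<comment> \<open>The product formula produces the angle \<phi> - (n + 1) \<phi> = - n \<phi>,
      whence \<open>cos_minus\<close>.\<close>
    have "cos (real (Suc (Suc n)) * \<phi>) + cos (real n * \<phi>) = 2 * cos \<phi> * cos (real (Suc n) * \<phi>)"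
      using cos_times_cos[of \<phi> "real (Suc n) * \<phi>"] cos_minus[of "real n * \<phi>"]
      by (simp add: algebra_simps)
    then have rec: "cos (real (Suc (Suc n)) * \<phi>) = 2 * cos \<phi> * cos (real (Suc n) * \<phi>) - cos (real n * \<phi>)"
      by simp
    have "poly (L_poly (of_real c) (Suc (Suc n))) (cis \<alpha>)
        = (1 + cis \<alpha> * cis \<alpha>) * poly (L_poly (of_real c) (Suc n)) (cis \<alpha>)
          - (cis \<alpha>)\<^sup>2 * (of_real c)\<^sup>2 * poly (L_poly (of_real c) n) (cis \<alpha>)"
      by (simp add: power2_eq_square algebra_simps)
    then show ?case
      unfolding 3 quad rec by (simp add: algebra_simps power2_eq_square del: of_nat_Suc)
  qed auto
qed

text \<open>Each point of \<open>T\<close> occurs at least once among the roots, and the degree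
  bounds their number with multiplicity, which leaves no room for further roots or
  repetitions.\<close>

lemma proots_eq_mset_set:
  fixes p :: "'a::idom poly"
  assumes "p \<noteq> 0" "finite T" "degree p \<le> card T" "\<And>z. z \<in> T \<Longrightarrow> poly p z = 0"
  shows "proots p = mset_set T"
proof -
  have "mset_set T \<subseteq># proots p"
    unfolding subseteq_mset_def
  proof
    fix z
    show "count (mset_set T) z \<le> count (proots p) z"
      using assms order_root[of p z] by (cases "z \<in> T") auto
  qed
  moreover have "size (proots p) \<le> size (mset_set T)"
    using assms size_proots_le[of p] by simp
  ultimately show ?thesis
    by (metis mset_subset_size subset_mset.le_imp_less_or_eq not_le)
qed

text \<open>The multiset equality gives location and simplicity at once. \<open>A\<close> collects
  the arguments of the roots in the upper half-plane; those in the lower one are their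
  conjugates.\<close>

lemma proots_L_poly:
  assumes "0 \<le> \<theta>" "\<theta> < pi / 4" "1 \<le> n"
  obtains A where "A \<subseteq> {2 * \<theta><..<pi - 2 * \<theta>}"
    "proots (L_poly (of_real (cos (2 * \<theta>))) n) = mset_set (cis ` (A \<union> uminus ` A))"
proof -
  define c where "c = cos (2 * \<theta>)"
  \<comment> \<open>The zeros of cos (n \<phi>) in (0, \<pi>) are the odd multiples of
    \<pi>/(2n).\<close>
  define \<phi> where "\<phi> k = (2 * real k + 1) * pi / (2 * real n)" for k
  define \<alpha> where "\<alpha> k = arccos (c * cos (\<phi> k))" for k
  define A where "A = \<alpha> ` {..<n}"
  \<comment> \<open>Positivity comes from 2 \<theta> < \<pi>/2. It keeps the bounds on
    \<open>c * cos (\<phi> k)\<close> strict and lets \<open>c\<close> be cancelled in the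
    injectivity argument.\<close>
  have c: "0 < c" "c \<le> 1"
    using assms by (auto simp: c_def intro!: cos_gt_zero_pi)
  have \<phi>: "0 < \<phi> k" "\<phi> k < pi" if "k < n" for k
  proof -
    show "0 < \<phi> k"
      using that by (auto simp: \<phi>_def intro!: divide_pos_pos mult_pos_pos add_nonneg_pos)
    have "(2 * real k + 1) * pi < 2 * real n * pi"
      using that by (intro mult_strict_right_mono) auto
    then show "\<phi> k < pi"
      using that by (simp add: \<phi>_def pos_divide_less_eq mult_ac)
  qed
  have cos_\<phi>: "-1 < cos (\<phi> k)" "cos (\<phi> k) < 1" if "k < n" for k
    using \<phi>[OF that] cos_monotone_0_pi[of "\<phi> k" pi] cos_monotone_0_pi[of 0 "\<phi> k"] by auto
  have bound: "-c < c * cos (\<phi> k)" "c * cos (\<phi> k) < c" if "k < n" for k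
    using mult_strict_left_mono[OF cos_\<phi>(1)[OF that] c(1)]
      mult_strict_left_mono[OF cos_\<phi>(2)[OF that] c(1)] by auto
  have cos_\<alpha>: "cos (\<alpha> k) = c * cos (\<phi> k)" if "k < n" for k
    unfolding \<alpha>_def by (rule cos_arccos) (use bound[OF that] c in linarith)+
  have \<alpha>: "\<alpha> k \<in> {2 * \<theta><..<pi - 2 * \<theta>}" if "k < n" for k
  proof -
    \<comment> \<open>The endpoints of the open arc are the arccosines of c and -c;
      \<open>arccos\<close> is strictly decreasing, so the strict bounds carry over.\<close>
    have "arccos c = 2 * \<theta>" "arccos (-c) = pi - 2 * \<theta>"
      using assms c by (auto simp: c_def arccos_cos arccos_minus)
    moreover have "arccos c < \<alpha> k" "\<alpha> k < arccos (-c)"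
      unfolding \<alpha>_def by (rule arccos_less_arccos; use bound[OF that] c in linarith)+
    ultimately show ?thesis
      by simp
  qed
  have inj_\<alpha>: "inj_on \<alpha> {..<n}"
  proof (rule inj_onI)
    fix j k assume jk: "j \<in> {..<n}" "k \<in> {..<n}" "\<alpha> j = \<alpha> k"
    then have "cos (\<phi> j) = cos (\<phi> k)"
      using cos_\<alpha>[of j] cos_\<alpha>[of k] c by simp
    then have "\<phi> j = \<phi> k"
      using \<phi>[of j] \<phi>[of k] jk by (auto intro: cos_inj_pi)
    then show "j = k"
      using assms by (simp add: \<phi>_def)
  qed
  have sub: "A \<subseteq> {2 * \<theta><..<pi - 2 * \<theta>}"
    using \<alpha> by (auto simp: A_def)
  \<comment> \<open>All these angles lie in the range of the principal argument, so
    \<open>Arg\<close> inverts \<open>cis\<close> on them.\<close>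
  have inj_cis: "inj_on cis (A \<union> uminus ` A)"
  proof (rule inj_on_inverseI[of _ Arg])
    fix a assume "a \<in> A \<union> uminus ` A"
    then have "-pi < a" "a \<le> pi"
      using sub assms by force+
    then show "Arg (cis a) = a"
      by (simp add: Arg_cis)
  qed
  \<comment> \<open>Disjointness makes the number of roots found exactly 2n, matching the degree
    bound.\<close>
  have "A \<inter> uminus ` A = {}"
  proof -
    have "a > 0" if "a \<in> A" for a
      using sub assms that by force
    then have "- a \<notin> A" if "a \<in> A" for a
      using that by (metis neg_0_less_iff_less less_asym)
    then show ?thesis
      by blast
  qed
  moreover have "card A = n" "card (uminus ` A) = n" "finite A"
    using inj_\<alpha> by (simp_all add: A_def card_image)
  ultimately have "card (cis ` (A \<union> uminus ` A)) = 2 * n"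
    using inj_cis by (simp add: card_image card_Un_disjoint)
  moreover have "poly (L_poly (of_real c) n) z = 0" if "z \<in> cis ` (A \<union> uminus ` A)" for z
  proof -
    obtain k a where k: "k < n" "z = cis a" "a = \<alpha> k \<or> a = - \<alpha> k"
      using \<open>z \<in> _\<close> by (auto simp: A_def)
    then have "cos a = c * cos (\<phi> k)"
      using cos_\<alpha> by auto
    moreover have "cos (real n * \<phi> k) = 0"
    proof -
      have "real n * \<phi> k = of_int (2 * int k + 1) * (pi / 2)"
        using assms by (simp add: \<phi>_def)
      then show ?thesis
        unfolding cos_zero_iff_int by (intro exI[of _ "2 * int k + 1"]) auto
    qed
    ultimately show ?thesis
      using poly_L_poly_cis[of a c "\<phi> k" n] k by simp
  qed
  moreover have "L_poly (of_real c) n \<noteq> 0"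
    using poly_L_poly_0[of n "of_real c"] assms by auto
  ultimately have "proots (L_poly (of_real c) n) = mset_set (cis ` (A \<union> uminus ` A))"
    using degree_L_poly_le \<open>finite A\<close> by (intro proots_eq_mset_set) auto
  with sub show thesis
    using that c_def by blast
qed

theorem theorem2p6:
  fixes \<theta> :: real and n :: nat
  assumes "0 \<le> \<theta>" and "\<theta> < pi / 4" and "1 \<le> n"
  shows "{z. z \<noteq> 0 \<and> L_laurent n (F_mat \<theta>) z = 0}
           \<subseteq> {z. cmod z = 1 \<and> 2 * \<theta> < Arg z \<and> Arg z < pi - 2 * \<theta>}
             \<union> {z. cmod z = 1 \<and> 2 * \<theta> < - Arg z \<and> - Arg z < pi - 2 * \<theta>}
       \<and> (\<forall>z. z \<noteq> 0 \<and> L_laurent n (F_mat \<theta>) z = 0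
             \<longrightarrow> laurent_root_multiplicity (L_laurent n (F_mat \<theta>)) z 1)"
proof -
  define p where "p = L_poly (of_real (cos (2 * \<theta>))) n"
  obtain A where A: "A \<subseteq> {2 * \<theta><..<pi - 2 * \<theta>}" "proots p = mset_set (cis ` (A \<union> uminus ` A))"
    using proots_L_poly[OF assms] unfolding p_def .
  have L: "L_laurent n (F_mat \<theta>) w = poly p w / w ^ n" if "w \<noteq> 0" for w
    using L_laurent_eq_L_poly[OF that] by (simp add: p_def)
  have "p \<noteq> 0"
    using poly_L_poly_0[of n "of_real (cos (2 * \<theta>))"] assms by (auto simp: p_def)
  have "(cmod z = 1 \<and> 2 * \<theta> < Arg z \<and> Arg z < pi - 2 * \<theta> \<or>
         cmod z = 1 \<and> 2 * \<theta> < - Arg z \<and> - Arg z < pi - 2 * \<theta>) \<and>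
        laurent_root_multiplicity (L_laurent n (F_mat \<theta>)) z 1"
    if z: "z \<noteq> 0" "L_laurent n (F_mat \<theta>) z = 0" for z
  proof
    have "z \<in># proots p"
      using z L[of z] \<open>p \<noteq> 0\<close> by simp
    \<comment> \<open>\<open>mset_set\<close> of an infinite set is empty, so the mere presence of
      an element forces finiteness.\<close>
    then have fin: "finite (cis ` (A \<union> uminus ` A))" and zT: "z \<in> cis ` (A \<union> uminus ` A)"
      unfolding A(2) by (metis elem_mset_set empty_iff mset_set.infinite set_mset_empty)+
    from zT obtain a where a: "z = cis a" "a \<in> A \<or> - a \<in> A"
      by auto
    then have "2 * \<theta> < a \<and> a < pi - 2 * \<theta> \<or> 2 * \<theta> < - a \<and> - a < pi - 2 * \<theta>"
      using A(1) by auto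
    \<comment> \<open>Either range keeps \<open>a\<close> strictly between -\<pi> and \<pi>, so it
      is the principal argument.\<close>
    moreover from this have "Arg z = a"
      using a assms by (auto intro!: Arg_cis)
    ultimately show "cmod z = 1 \<and> 2 * \<theta> < Arg z \<and> Arg z < pi - 2 * \<theta> \<or>
        cmod z = 1 \<and> 2 * \<theta> < - Arg z \<and> - Arg z < pi - 2 * \<theta>"
      using a by auto
    have "order z p = 1"
      using count_proots[OF \<open>p \<noteq> 0\<close>, of z] fin zT by (simp add: A(2))
    then show "laurent_root_multiplicity (L_laurent n (F_mat \<theta>)) z 1"
      unfolding laurent_root_multiplicity_def using z L \<open>p \<noteq> 0\<close> by blast
  qed
  then show ?thesis
    by blast
qed

end
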